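(* The metrics $\tilde d_R$ and $\tilde d_S$ are equivalent when restricted to the set $\mathbb{R}\setminus\mathbb{Q}$ of irrational numbers; that is, for every sequence $(x_i)$ in $\mathbb{R}\setminus\mathbb{Q}$ and every $x\in\mathbb{R}\setminus\mathbb{Q}$, $\tilde d_R(x_i,x)\to0$ if and only if $\tilde d_S(x_i,x)\to 0$.
   Context: Let $\mathbb{R}^\epsilon=\{a+b\epsilon:a,b\in\mathbb{R}\}$ be the two-dimensional real vector space with basis $\{1,\epsilon\}$, totally ordered by $a+b\epsilon<c+d\epsilon$ iff $a<c$, or $a=c$ and $b<d$; intervals in $\mathbb{R}^\epsilon$ are taken with respect to this order. An infinite hallway is a set $H=\bigcup_{i\ge 0}\{i\}\times(\mathbb{R}^\epsilon\setminus D_i)\subset\mathbb{R}\times\mathbb{R}^\epsilon$, where $D_i=(d_i,d_i+1)\subset\mathbb{R}^\epsilon$ with $d_i\in\mathbb{Z}$ for $i\ge 0$ (the $i$th doorway); it is assumed throughout that $D_0=(0,1)$. For $\alpha,\beta\in\mathbb{R}$ let $\ell_{\alpha\beta}=\{(x,\alpha x+\beta):x\in\mathbb{R}\}$ and $\ell^\epsilon_{\alpha\beta}=\{(x,\alpha x+\beta+t\epsilon):x,t\in\mathbb{R}\}$, and for $(x,y)\in\mathbb{R}\times\mathbb{R}^\epsilon$ let $\mathrm{proj}_\alpha(x,y)=y-\alpha x$. Define $\ell^\epsilon_{\alpha\beta}\vee H=\{a\in\mathbb{R}: a+b\epsilon\in \mathrm{proj}_\alpha(\ell^\epsilon_{\alpha\beta})\cap(\mathbb{R}^\epsilon\setminus\mathrm{proj}_\alpha(H))\text{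 for some }b\in\mathbb{R}\}$; $\ell^\epsilon_{\alpha\beta}$ is a line of sight for $H$ if $\ell^\epsilon_{\alpha\beta}\vee H\neq\emptyset$. All lines of sight of a given infinite hallway $H$ that admits one have the same slope, denoted $s(H)$. For $\alpha\in\mathbb{R}$ let $s^{-1}(\alpha)$ be the set of infinite hallways admitting a line of sight of slope $\alpha$. Distances on hallways. For infinite hallways $H\ne H'$ with doorways $D_i=(d_i,d_i+1)$, $D_i'$, let $n=\min\{k: D_k\neq D_k'\}\ge 1$. Set $d_S(H,H')=1/n$ and $d_S(H,H)=0$. The common initial segment $\mathrm{comm}(H,H')$ is the finite hallway with the shared doorways $D_0,\dots,D_{n-1}$; it admits a line of sight if there are $\alpha,\beta\in\mathbb{R}$ with $d_i<\alpha i+\beta<d_i+1$ for $0\le i\le n-1$. The unframed hallway $\bar H$ is obtained from $H$ by replacing each doorway $(d_i,d_i+1)$ by $[d_i,d_i+1]$; a real line $\ell_{\alpha\beta}$ is a line of sight for $\mathrm{comm}(\bar H,\bar H')$ if $d_i\le\alpha i+\beta\le d_i+1$ for $0\le i\le n-1$. Set $d_R(H,H)=0$; if $H\neq H'$ and $\mathrm{comm}(H,H')$ admits a line of sight, set $d_R(H,H')=\max\{\tfrac1q: q\in\mathbb{Z}_{>0},\ \ell_{\frac pq\beta}\text{ is a line of sight for }\mathrm{comm}(\bar H,\bar H')\text{ for some }\beta\in\mathbb{R},p\in\mathbb{Z}\}$; if $H\ne H'$ and $\mathrm{comm}(H,H')$ admits no line of sight, set $d_R(H,H')=\infty$. For $d\in\{d_S,d_R\}$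 the induced distance on $\mathbb{R}$ is $\tilde d(\alpha,\gamma)=d(s^{-1}(\alpha),s^{-1}(\gamma))=\inf\{d(H,H'):H\in s^{-1}(\alpha),H'\in s^{-1}(\gamma)\}$. *)

theory Defs
  imports "HOL-Analysis.Analysis"
begin

(* Eps a b stands for a + b\<epsilon>. The type is new because real \<times> real already carries
   the product order once HOL-Analysis is loaded, and the lexicographic order is needed here. *)
datatype eps_real = Eps (std_part: real) (eps_part: real)

instantiation eps_real :: real_vector
begin

definition zero_eps_real :: eps_real where
  "0 = Eps 0 0"

definition plus_eps_real :: "eps_real \<Rightarrow> eps_real \<Rightarrow> eps_real" where
  "y + z = Eps (std_part y + std_part z) (eps_part y + eps_part z)"

definition uminus_eps_real :: "eps_real \<Rightarrow> eps_real" where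
  "- y = Eps (- std_part y) (- eps_part y)"

definition minus_eps_real :: "eps_real \<Rightarrow> eps_real \<Rightarrow> eps_real" where
  "y - z = Eps (std_part y - std_part z) (eps_part y - eps_part z)"

definition scaleR_eps_real :: "real \<Rightarrow> eps_real \<Rightarrow> eps_real" where
  "r *\<^sub>R y = Eps (r * std_part y) (r * eps_part y)"

instance
  by standard
    (simp_all add: zero_eps_real_def plus_eps_real_def uminus_eps_real_def
      minus_eps_real_def scaleR_eps_real_def algebra_simps)

end

instantiation eps_real :: linorder
begin

definition less_eps_real :: "eps_real \<Rightarrow> eps_real \<Rightarrow> bool" where
  "y < z \<longleftrightarrow> std_part y < std_part z \<or> (std_part y = std_part z \<and> eps_part y < eps_part z)"

definition less_eq_eps_real :: "eps_real \<Rightarrow> eps_real \<Rightarrow> bool" where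
  "y \<le> z \<longleftrightarrow> y < z \<or> y = (z :: eps_real)"

instance
proof
  fix y z :: eps_real
  show "y \<le> z \<or> z \<le> y"
    by (cases y; cases z) (auto simp: less_eps_real_def less_eq_eps_real_def)
qed (auto simp: less_eps_real_def less_eq_eps_real_def)

end

definition std :: "real \<Rightarrow> eps_real" where
  "std a = Eps a 0"

definition eps :: eps_real where
  "eps = Eps 0 1"

definition doorway :: "int \<Rightarrow> eps_real set" where
  "doorway k = {std (of_int k) <..< std (of_int k + 1)}"

(* An infinite hallway is represented by the integer sequence (d_i) of its doorways
   D_i = (d_i, d_i + 1), normalised by D_0 = (0, 1). The sequence is recovered from
   hallway_set, as {i} \<times> R^\<epsilon> minus the hallway is {i} \<times> D_i. *)
definition infinite_hallways :: "(nat \<Rightarrow> int) set" where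
  "infinite_hallways = {H. H 0 = 0}"

definition hallway_set :: "(nat \<Rightarrow> int) \<Rightarrow> (real \<times> eps_real) set" where
  "hallway_set H = (\<Union>i. {real i} \<times> (UNIV - doorway (H i)))"

definition eps_line :: "real \<Rightarrow> real \<Rightarrow> (real \<times> eps_real) set" where
  "eps_line \<alpha> \<beta> = {(x, std (\<alpha> * x + \<beta>) + t *\<^sub>R eps) | x t. True}"

definition slope_proj :: "real \<Rightarrow> real \<times> eps_real \<Rightarrow> eps_real" where
  "slope_proj \<alpha> = (\<lambda>(x, y). y - std (\<alpha> * x))"

definition vee :: "real \<Rightarrow> real \<Rightarrow> (nat \<Rightarrow> int) \<Rightarrow> real set" where
  "vee \<alpha> \<beta> H = {a. \<exists>b. std a + b *\<^sub>R eps \<in>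
     slope_proj \<alpha> ` eps_line \<alpha> \<beta> \<inter> (UNIV - slope_proj \<alpha> ` hallway_set H)}"

definition line_of_sight :: "real \<Rightarrow> real \<Rightarrow> (nat \<Rightarrow> int) \<Rightarrow> bool" where
  "line_of_sight \<alpha> \<beta> H \<longleftrightarrow> vee \<alpha> \<beta> H \<noteq> {}"

(* s^{-1}(\<alpha>) *)
definition slope_fibre :: "real \<Rightarrow> (nat \<Rightarrow> int) set" where
  "slope_fibre \<alpha> = {H \<in> infinite_hallways. \<exists>\<beta>. line_of_sight \<alpha> \<beta> H}"

definition first_diff :: "(nat \<Rightarrow> int) \<Rightarrow> (nat \<Rightarrow> int) \<Rightarrow> nat" where
  "first_diff H H' = (LEAST k. doorway (H k) \<noteq> doorway (H' k))"

(* A finite hallway is the list of the left endpoints of its doorways; the same list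
   represents its unframed version. *)
definition comm :: "(nat \<Rightarrow> int) \<Rightarrow> (nat \<Rightarrow> int) \<Rightarrow> int list" where
  "comm H H' = map H [0..<first_diff H H']"

definition finite_admits_line_of_sight :: "int list \<Rightarrow> bool" where
  "finite_admits_line_of_sight F \<longleftrightarrow> (\<exists>\<alpha> \<beta>. \<forall>i<length F.
     of_int (F ! i) < \<alpha> * real i + \<beta> \<and> \<alpha> * real i + \<beta> < of_int (F ! i) + 1)"

definition unframed_line_of_sight :: "real \<Rightarrow> real \<Rightarrow> int list \<Rightarrow> bool" where
  "unframed_line_of_sight \<alpha> \<beta> F \<longleftrightarrow> (\<forall>i<length F.
     of_int (F ! i) \<le> \<alpha> * real i + \<beta> \<and> \<alpha> * real i + \<beta> \<le> of_int (F ! i) + 1)"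

definition dist_S :: "(nat \<Rightarrow> int) \<Rightarrow> (nat \<Rightarrow> int) \<Rightarrow> ennreal" where
  "dist_S H H' = (if H = H' then 0 else ennreal (1 / real (first_diff H H')))"

(* GREATEST rather than Max, since the set of all such 1/q may be infinite. *)
definition dist_R :: "(nat \<Rightarrow> int) \<Rightarrow> (nat \<Rightarrow> int) \<Rightarrow> ennreal" where
  "dist_R H H' =
     (if H = H' then 0
      else if finite_admits_line_of_sight (comm H H')
      then ennreal (GREATEST r. \<exists>q::nat. q > 0 \<and> r = 1 / real q \<and>
             (\<exists>\<beta> (p::int). unframed_line_of_sight (of_int p / real q) \<beta> (comm H H')))
      else \<infinity>)"

definition induced_dist ::
  "((nat \<Rightarrow> int) \<Rightarrow> (nat \<Rightarrow> int) \<Rightarrow> ennreal) \<Rightarrow> real \<Rightarrow> real \<Rightarrow> ennreal" where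
  "induced_dist d \<alpha> \<gamma> = Inf {d H H' | H H'. H \<in> slope_fibre \<alpha> \<and> H' \<in> slope_fibre \<gamma>}"

end

theory Submission
  imports Defs
begin

text \<open>
  Only the initial segment \<open>comm H H'\<close> enters either distance: \<open>dist_S\<close> is small when the segment
  is long, and \<open>dist_R\<close> is small when no line of rational slope with small denominator passes
  through its closed doorways. Each kind of smallness forces the other, uniformly in the pair
  \<open>H\<close>, \<open>H'\<close> of hallways with lines of sight, as long as that of \<open>H'\<close> has the fixed slope \<open>\<gamma>\<close>.

  \<^item> Two lines through the same \<open>n\<close> closed doorways have slopes that differ by at most
  \<open>2 / (n - 1)\<close>. So a long common segment confines the slopes of its lines to a small
  neighbourhood of \<open>\<gamma>\<close>, and near an irrational number all fractions have large denominators
  (\<open>dist_R_small_if_dist_S_small\<close>).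

  \<^item> There are only finitely many initial segments of length at most \<open>N\<close> of hallways with a line of
  sight of slope \<open>\<gamma>\<close>. Each of them admits a line of sight that avoids the frames; this remains true
  after a small change of slope, so there is also one of rational slope. Hence a single bound \<open>Q\<close> on the least
  denominators works for all of them, and \<open>dist_R < 1 / Q\<close> forces the segment to be longer than
  \<open>N\<close> (\<open>dist_S_small_if_dist_R_small\<close>).

  Such a uniform comparison passes to the infima over the fibres
  (\<open>induced_dist_tendsto_0_transfer\<close>), which gives the two implications.
\<close>

section \<open>Lines of sight through finitely many doorways\<close>

text \<open>
  A line of sight at infinitesimal offset \<open>b\<close> lets the real line touch the frames of the doorways,
  but only on one side: the lower frames if \<open>b > 0\<close> and the upper ones if \<open>b < 0\<close>.
\<close>

lemma slope_fibreE:
  assumes "H \<in> slope_fibre \<alpha>"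
  obtains \<beta> where "H 0 = 0"
    and "(\<forall>i. H i \<le> \<alpha> * real i + \<beta> \<and> \<alpha> * real i + \<beta> < of_int (H i) + 1) \<or>
         (\<forall>i. H i < \<alpha> * real i + \<beta> \<and> \<alpha> * real i + \<beta> \<le> of_int (H i) + 1)"
proof -
  obtain \<beta>' a b where H0: "H 0 = 0"
    and out: "std a + b *\<^sub>R eps \<notin> slope_proj \<alpha> ` hallway_set H"
    using assms
    by (auto simp: slope_fibre_def infinite_hallways_def line_of_sight_def vee_def)
  have thru: "Eps (\<alpha> * real i + a) b \<in> doorway (H i)" for i
  proof (rule ccontr)
    assume "Eps (\<alpha> * real i + a) b \<notin> doorway (H i)"
    then have "(real i, Eps (\<alpha> * real i + a) b) \<in> hallway_set H"
      by (auto simp: hallway_set_def)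
    moreover have "slope_proj \<alpha> (real i, Eps (\<alpha> * real i + a) b) = std a + b *\<^sub>R eps"
      by (simp add: slope_proj_def std_def eps_def plus_eps_real_def minus_eps_real_def
          scaleR_eps_real_def)
    ultimately show False
      using out by (metis imageI)
  qed
  show thesis
  proof (rule that[OF H0, of a], cases "b \<ge> 0")
    case True
    then have "H i \<le> \<alpha> * real i + a \<and> \<alpha> * real i + a < of_int (H i) + 1" for i
      using thru[of i] by (auto simp: doorway_def less_eps_real_def std_def)
    then show "(\<forall>i. H i \<le> \<alpha> * real i + a \<and> \<alpha> * real i + a < of_int (H i) + 1) \<or>
         (\<forall>i. H i < \<alpha> * real i + a \<and> \<alpha> * real i + a \<le> of_int (H i) + 1)" by blast
  next
    case False
    then have "H i < \<alpha> * real i + a \<and> \<alpha> * real i + a \<le> of_int (H i) + 1" for i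
      using thru[of i] by (auto simp: doorway_def less_eps_real_def std_def)
    then show "(\<forall>i. H i \<le> \<alpha> * real i + a \<and> \<alpha> * real i + a < of_int (H i) + 1) \<or>
         (\<forall>i. H i < \<alpha> * real i + a \<and> \<alpha> * real i + a \<le> of_int (H i) + 1)" by blast
  qed
qed

lemma slope_fibre_closed_lineE:
  assumes "H \<in> slope_fibre \<alpha>"
  obtains \<beta> where "H 0 = 0" "0 \<le> \<beta>" "\<beta> \<le> 1"
    and "\<And>i. H i \<le> \<alpha> * real i + \<beta>" "\<And>i. \<alpha> * real i + \<beta> \<le> of_int (H i) + 1"
proof -
  obtain \<beta> where H0: "H 0 = 0" and line: "H i \<le> \<alpha> * real i + \<beta>" "\<alpha> * real i + \<beta> \<le> of_int (H i) + 1" for i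
    by (rule slope_fibreE[OF assms]) (meson less_imp_le)
  show thesis
    using that[OF H0 _ _ line] line[of 0] H0 by simp
qed

text \<open>
  A line that touches frames on one side only can be shifted off finitely many of them at once.
\<close>

lemma initial_segment_admits_line_of_sight:
  assumes "H \<in> slope_fibre \<alpha>"
  shows "finite_admits_line_of_sight (map H [0..<n])"
proof -
  obtain \<beta> where line:
    "(\<forall>i. H i \<le> \<alpha> * real i + \<beta> \<and> \<alpha> * real i + \<beta> < of_int (H i) + 1) \<or>
     (\<forall>i. H i < \<alpha> * real i + \<beta> \<and> \<alpha> * real i + \<beta> \<le> of_int (H i) + 1)"
    by (rule slope_fibreE[OF assms])
  have "\<exists>c. \<forall>i<n. H i < \<alpha> * real i + c \<and> \<alpha> * real i + c < of_int (H i) + 1"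
    using line
  proof
    assume low: "\<forall>i. H i \<le> \<alpha> * real i + \<beta> \<and> \<alpha> * real i + \<beta> < of_int (H i) + 1"
    have "\<forall>\<^sub>F c in at_right \<beta>. \<forall>i\<in>{..<n}. H i < \<alpha> * real i + c \<and> \<alpha> * real i + c < of_int (H i) + 1"
    proof (intro eventually_ball_finite ballI finite_lessThan)
      fix i
      have "\<forall>\<^sub>F c in at_right \<beta>. c \<in> {\<beta><..<of_int (H i) + 1 - \<alpha> * real i}"
        using low[rule_format, of i] by (intro eventually_at_right_real) simp
      then show "\<forall>\<^sub>F c in at_right \<beta>. H i < \<alpha> * real i + c \<and> \<alpha> * real i + c < of_int (H i) + 1"
        by eventually_elim (use low[rule_format, of i] in auto)
    qed
    from eventually_happens'[OF trivial_limit_at_right_real this] show ?thesis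
      by auto
  next
    assume up: "\<forall>i. H i < \<alpha> * real i + \<beta> \<and> \<alpha> * real i + \<beta> \<le> of_int (H i) + 1"
    have "\<forall>\<^sub>F c in at_left \<beta>. \<forall>i\<in>{..<n}. H i < \<alpha> * real i + c \<and> \<alpha> * real i + c < of_int (H i) + 1"
    proof (intro eventually_ball_finite ballI finite_lessThan)
      fix i
      have "\<forall>\<^sub>F c in at_left \<beta>. c \<in> {H i - \<alpha> * real i<..<\<beta>}"
        using up[rule_format, of i] by (intro eventually_at_left_real) simp
      then show "\<forall>\<^sub>F c in at_left \<beta>. H i < \<alpha> * real i + c \<and> \<alpha> * real i + c < of_int (H i) + 1"
        by eventually_elim (use up[rule_format, of i] in auto)
    qed
    from eventually_happens'[OF trivial_limit_at_left_real this] show ?thesis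
      by auto
  qed
  then show ?thesis
    by (auto simp: finite_admits_line_of_sight_def)
qed

definition rational_slope_denominator :: "int list \<Rightarrow> nat \<Rightarrow> bool" where
  "rational_slope_denominator F q \<longleftrightarrow>
     q > 0 \<and> (\<exists>\<beta> (p::int). unframed_line_of_sight (of_int p / real q) \<beta> F)"

text \<open>
  With the intercept fixed, the slopes of lines through the open doorways form an open set, and the
  rationals are dense.
\<close>

lemma rational_slope_denominator_exists:
  assumes "finite_admits_line_of_sight F"
  shows "\<exists>q. rational_slope_denominator F q"
proof -
  obtain \<alpha> \<beta> where line: "\<forall>i<length F. F ! i < \<alpha> * real i + \<beta> \<and> \<alpha> * real i + \<beta> < of_int (F ! i) + 1"
    using assms by (auto simp: finite_admits_line_of_sight_def)
  let ?S = "\<Inter>i\<in>{..<length F}. {a. F ! i < a * real i + \<beta>} \<inter> {a. a * real i + \<beta> < of_int (F ! i) + 1}"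
  have "open ?S"
    by (intro open_INT finite_lessThan ballI open_Int open_Collect_less continuous_intros)
  moreover have "\<alpha> \<in> ?S"
    using line by auto
  ultimately obtain \<delta> where "\<delta> > 0" and ball: "\<And>a. dist a \<alpha> < \<delta> \<Longrightarrow> a \<in> ?S"
    unfolding open_dist by blast
  obtain r where "r \<in> \<rat>" "\<alpha> < r" "r < \<alpha> + \<delta>"
    using Rats_dense_in_real[of \<alpha> "\<alpha> + \<delta>"] \<open>\<delta> > 0\<close> by auto
  then have "r \<in> ?S"
    by (intro ball) (simp add: dist_real_def)
  moreover obtain p :: int and q :: nat where "q \<noteq> 0" "r = of_int p / real q"
    using \<open>r \<in> \<rat>\<close> unfolding Rats_eq_int_div_nat by blast
  ultimately have "unframed_line_of_sight (of_int p / real q) \<beta> F"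
    unfolding unframed_line_of_sight_def by (blast intro: less_imp_le)
  then show ?thesis
    using \<open>q \<noteq> 0\<close> by (auto simp: rational_slope_denominator_def)
qed

section \<open>The two distances on hallways\<close>

text \<open>
  The set of all \<open>1 / q\<close> may be infinite, but it has a greatest element as soon as it is nonempty,
  because the denominators have a least one.
\<close>

lemma dist_R_eq_inverse_Least:
  assumes "H \<noteq> H'" and adm: "finite_admits_line_of_sight (comm H H')"
  shows "dist_R H H' = ennreal (1 / real (LEAST q. rational_slope_denominator (comm H H') q))"
proof -
  let ?P = "rational_slope_denominator (comm H H')"
  have P: "?P (LEAST q. ?P q)"
    using rational_slope_denominator_exists[OF adm] by (rule LeastI_ex)
  have "(GREATEST r. \<exists>q. r = 1 / real q \<and> ?P q) = 1 / real (LEAST q. ?P q)"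
  proof (rule Greatest_equality)
    fix r assume "\<exists>q. r = 1 / real q \<and> ?P q"
    then obtain q where "r = 1 / real q" "?P q" by blast
    moreover have "(LEAST q. ?P q) \<le> q"
      using \<open>?P q\<close> by (rule Least_le)
    moreover have "(LEAST q. ?P q) > 0"
      using P by (simp add: rational_slope_denominator_def)
    ultimately show "r \<le> 1 / real (LEAST q. ?P q)"
      by (simp add: frac_le)
  qed (use P in blast)
  then show ?thesis
    using assms by (simp add: dist_R_def rational_slope_denominator_def conj_ac)
qed

lemma doorway_inject:
  assumes "doorway k = doorway m"
  shows "k = m"
proof -
  have "Eps (of_int k + 1/2) 0 \<in> doorway k"
    by (auto simp: doorway_def less_eps_real_def std_def)
  then show ?thesis
    unfolding assms by (auto simp: doorway_def less_eps_real_def std_def)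
qed

lemma first_diff_pos:
  assumes "H \<noteq> H'" "H 0 = H' 0"
  shows "first_diff H H' > 0"
proof -
  have "\<exists>k. doorway (H k) \<noteq> doorway (H' k)"
    using assms(1) doorway_inject by blast
  then have "doorway (H (first_diff H H')) \<noteq> doorway (H' (first_diff H H'))"
    unfolding first_diff_def by (rule LeastI_ex)
  then show ?thesis
    using assms(2) by (metis neq0_conv)
qed

lemma comm_eq_right: "comm H H' = map H' [0..<first_diff H H']"
proof -
  have "H k = H' k" if "k < first_diff H H'" for k
    using not_less_Least[OF that[unfolded first_diff_def]] by (intro doorway_inject) simp
  then show ?thesis
    by (simp add: comm_def)
qed

lemma dist_S_less_iff:
  assumes "H \<noteq> H'" "H 0 = H' 0" "N > 0"
  shows "dist_S H H' < ennreal (1 / real N) \<longleftrightarrow> N < first_diff H H'"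
  using assms first_diff_pos[OF assms(1,2)]
  by (simp add: dist_S_def ennreal_less_iff field_simps)

lemma dist_R_less_iff:
  assumes "H \<noteq> H'" "finite_admits_line_of_sight (comm H H')" "Q > 0"
  shows "dist_R H H' < ennreal (1 / real Q) \<longleftrightarrow>
    (\<forall>q. rational_slope_denominator (comm H H') q \<longrightarrow> Q < q)"
proof -
  let ?P = "rational_slope_denominator (comm H H')"
  have P: "?P (LEAST q. ?P q)"
    using rational_slope_denominator_exists[OF assms(2)] by (rule LeastI_ex)
  then have "(LEAST q. ?P q) > 0"
    by (simp add: rational_slope_denominator_def)
  then have "dist_R H H' < ennreal (1 / real Q) \<longleftrightarrow> Q < (LEAST q. ?P q)"
    using assms by (simp add: dist_R_eq_inverse_Least ennreal_less_iff field_simps)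
  also have "\<dots> \<longleftrightarrow> (\<forall>q. ?P q \<longrightarrow> Q < q)"
    using P by (meson Least_le less_le_trans)
  finally show ?thesis .
qed

section \<open>Comparing the distances\<close>

text \<open>
  For each \<open>q\<close>, the fractions with denominator \<open>q\<close> stay at least \<open>gap q > 0\<close> away from \<open>x\<close>; only
  finitely many \<open>q\<close> have to be excluded.
\<close>

lemma fractions_near_irrational_have_large_denominator:
  assumes "x \<notin> \<rat>"
  shows "\<exists>\<delta>>0. \<forall>(p::int) q::nat. 0 < q \<and> \<bar>of_int p / real q - x\<bar> < \<delta> \<longrightarrow> Q < q"
proof -
  define gap where "gap q = \<bar>of_int (round (real q * x)) - real q * x\<bar> / real q" for q :: nat
  have gap_pos: "gap q > 0" if "q > 0" for q
  proof -
    have "of_int (round (real q * x)) \<noteq> real q * x"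
    proof
      assume "of_int (round (real q * x)) = real q * x"
      then have "x = of_int (round (real q * x)) / of_nat q"
        using that by (simp add: field_simps)
      then show False
        using assms by (metis Rats_divide Rats_of_int Rats_of_nat)
    qed
    then show ?thesis
      using that by (simp add: gap_def)
  qed
  have gap_le: "gap q \<le> \<bar>of_int p / real q - x\<bar>" if "q > 0" for p :: int and q
  proof -
    have "\<bar>of_int (round (real q * x)) - real q * x\<bar> \<le> \<bar>of_int p - real q * x\<bar>"
      using round_diff_minimal[of "real q * x" p] by (simp add: abs_minus_commute)
    moreover have "of_int p / real q - x = (of_int p - real q * x) / real q"
      using that by (simp add: field_simps)
    ultimately show ?thesis
      using that by (simp add: gap_def divide_right_mono)
  qed
  \<comment> \<open>The extra \<open>1\<close> keeps the minimum defined for \<open>Q = 0\<close>.\<close>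
  let ?\<delta> = "Min (insert 1 (gap ` {1..Q}))"
  have "?\<delta> > 0"
    using gap_pos by (subst Min_gr_iff) auto
  moreover have "Q < q" if "0 < q" "\<bar>of_int p / real q - x\<bar> < ?\<delta>" for p :: int and q
  proof (rule ccontr)
    assume "\<not> Q < q"
    with that have "?\<delta> \<le> gap q"
      by (intro Min_le) auto
    with that gap_le[of q p] show False
      by linarith
  qed
  ultimately show ?thesis
    by blast
qed

text \<open>
  The first and the last doorway alone confine the slope: at both ends, two lines through the same
  closed doorway are at vertical distance at most \<open>1\<close>.
\<close>

lemma slope_deviation_le:
  assumes "H \<in> slope_fibre \<gamma>" "unframed_line_of_sight \<alpha> \<beta> (map H [0..<n])" "n > 0"
  shows "\<bar>\<alpha> - \<gamma>\<bar> * (real n - 1) \<le> 2"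
proof -
  obtain \<beta>' where H0: "H 0 = 0" "0 \<le> \<beta>'" "\<beta>' \<le> 1"
    and line': "H i \<le> \<gamma> * real i + \<beta>'" "\<gamma> * real i + \<beta>' \<le> of_int (H i) + 1" for i
    using slope_fibre_closed_lineE[OF assms(1)] by metis
  have line: "H i \<le> \<alpha> * real i + \<beta>" "\<alpha> * real i + \<beta> \<le> of_int (H i) + 1" if "i < n" for i
    using assms(2) that by (auto simp: unframed_line_of_sight_def)
  have "0 \<le> \<beta>" "\<beta> \<le> 1"
    using line[of 0] H0 assms(3) by auto
  moreover have "\<bar>(\<alpha> * real (n - 1) + \<beta>) - (\<gamma> * real (n - 1) + \<beta>')\<bar> \<le> 1"
    using line[of "n - 1"] line'[of "n - 1"] assms(3) by linarith
  ultimately have "\<bar>\<alpha> * real (n - 1) - \<gamma> * real (n - 1)\<bar> \<le> 2"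
    using H0 by linarith
  moreover have "\<bar>\<alpha> * real (n - 1) - \<gamma> * real (n - 1)\<bar> = \<bar>\<alpha> - \<gamma>\<bar> * real (n - 1)"
    by (simp flip: left_diff_distrib add: abs_mult)
  ultimately show ?thesis
    using assms(3) by (simp add: of_nat_diff)
qed

lemma ex_inverse_Suc_less_ennreal:
  fixes e :: ennreal
  assumes "e > 0"
  shows "\<exists>n. ennreal (1 / real (Suc n)) < e"
proof (cases e)
  case (real r)
  then obtain n where "1 / real (Suc n) < r"
    using assms nat_approx_posE[of r] by (auto simp: ennreal_less_zero_iff)
  then show ?thesis
    using real by (intro exI[of _ n]) (simp add: ennreal_less_iff)
qed simp

text \<open>
  The required length of the common segment comes from \<open>slope_deviation_le\<close>: beyond \<open>2 / \<delta>\<close>, all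
  slopes of lines through it are within \<open>\<delta>\<close> of \<open>\<gamma>\<close>, where no small denominators occur.
\<close>

lemma dist_R_small_if_dist_S_small:
  assumes "\<gamma> \<notin> \<rat>" "e > 0"
  shows "\<exists>d>0. \<forall>\<alpha>. \<forall>H\<in>slope_fibre \<alpha>. \<forall>H'\<in>slope_fibre \<gamma>. dist_S H H' < d \<longrightarrow> dist_R H H' < e"
proof -
  obtain m where m: "ennreal (1 / real (Suc m)) < e"
    using ex_inverse_Suc_less_ennreal[OF assms(2)] by blast
  obtain \<delta> where \<delta>: "\<delta> > 0"
    and large: "\<And>(p::int) q::nat. 0 < q \<Longrightarrow> \<bar>of_int p / real q - \<gamma>\<bar> < \<delta> \<Longrightarrow> Suc m < q"
    using fractions_near_irrational_have_large_denominator[OF assms(1), of "Suc m"] by blast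
  obtain N :: nat where N: "2 / \<delta> < real N"
    using reals_Archimedean2 by blast
  have "N > 0"
    using N \<delta> by (metis divide_pos_pos less_trans of_nat_0_less_iff zero_less_numeral)
  have "dist_R H H' < e"
    if H: "H \<in> slope_fibre \<alpha>" and H': "H' \<in> slope_fibre \<gamma>"
      and small: "dist_S H H' < ennreal (1 / real N)" for \<alpha> H H'
  proof (cases "H = H'")
    case True
    then show ?thesis
      using assms(2) by (simp add: dist_R_def)
  next
    case False
    have "H 0 = H' 0"
      using H H' by (simp add: slope_fibre_def infinite_hallways_def)
    then have n: "N < first_diff H H'"
      using dist_S_less_iff[OF False _ \<open>N > 0\<close>] small by blast
    have "Suc m < q" if q: "rational_slope_denominator (comm H H') q" for q
    proof -
      obtain p :: int and \<beta> where "q > 0"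
        and los: "unframed_line_of_sight (of_int p / real q) \<beta> (map H' [0..<first_diff H H'])"
        using q by (auto simp: rational_slope_denominator_def comm_eq_right)
      let ?t = "\<bar>of_int p / real q - \<gamma>\<bar>"
      have "?t * real N \<le> ?t * (real (first_diff H H') - 1)"
        using n by (intro mult_left_mono) auto
      also have "\<dots> \<le> 2"
        using slope_deviation_le[OF H' los] n by simp
      also have "\<dots> < \<delta> * real N"
        using N \<delta> by (simp add: field_simps)
      finally have "?t < \<delta>"
        using \<open>N > 0\<close> by simp
      then show ?thesis
        using large \<open>q > 0\<close> by blast
    qed
    moreover have "finite_admits_line_of_sight (comm H H')"
      using initial_segment_admits_line_of_sight[OF H] by (simp add: comm_def)
    ultimately have "dist_R H H' < ennreal (1 / real (Suc m))"
      by (subst dist_R_less_iff[OF False]) auto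
    then show ?thesis
      using m by (rule less_trans)
  qed
  moreover have "ennreal (1 / real N) > 0"
    using \<open>N > 0\<close> by simp
  ultimately show ?thesis
    by blast
qed

text \<open>
  The normalisation \<open>H 0 = 0\<close> bounds the intercept of the line by \<open>1\<close>, so each doorway has only
  finitely many possible positions.
\<close>

lemma finite_initial_segments:
  "finite {map H [0..<n] | H n. H \<in> slope_fibre \<gamma> \<and> n \<le> N}"
proof (rule finite_subset)
  let ?B = "\<lceil>\<bar>\<gamma>\<bar> * real N\<rceil> + 1"
  show "{map H [0..<n] | H n. H \<in> slope_fibre \<gamma> \<and> n \<le> N}
      \<subseteq> {F. set F \<subseteq> {- ?B..?B} \<and> length F \<le> N}"
  proof safe
    fix H n i assume H: "H \<in> slope_fibre \<gamma>" and n: "n \<le> N" and i: "i \<in> set (map H [0..<n])"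
    then obtain k where k: "k < n" "i = H k" by auto
    obtain \<beta> where "0 \<le> \<beta>" "\<beta> \<le> 1" "H k \<le> \<gamma> * real k + \<beta>" "\<gamma> * real k + \<beta> \<le> of_int (H k) + 1"
      using slope_fibre_closed_lineE[OF H] by metis
    moreover have "\<bar>\<gamma> * real k\<bar> \<le> \<bar>\<gamma>\<bar> * real N"
      using k n by (auto simp: abs_mult intro!: mult_left_mono)
    ultimately show "i \<in> {- ?B..?B}"
      unfolding k atLeastAtMost_iff by linarith
  qed auto
  show "finite {F. set F \<subseteq> {- ?B..?B} \<and> length F \<le> N}"
    by (intro finite_lists_length_le) simp
qed

text \<open>
  Every short segment already has a line of rational slope, and \<open>Q\<close> bounds one such denominator for
  each of the finitely many short segments.
\<close>

lemma dist_S_small_if_dist_R_small: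
  assumes "e > 0"
  shows "\<exists>d>0. \<forall>\<alpha>. \<forall>H\<in>slope_fibre \<alpha>. \<forall>H'\<in>slope_fibre \<gamma>. dist_R H H' < d \<longrightarrow> dist_S H H' < e"
proof -
  obtain m where m: "ennreal (1 / real (Suc m)) < e"
    using ex_inverse_Suc_less_ennreal[OF assms] by blast
  define \<F> where "\<F> = {map H [0..<n] | H n. H \<in> slope_fibre \<gamma> \<and> n \<le> Suc m}"
  have "\<forall>F\<in>\<F>. \<exists>q. rational_slope_denominator F q"
    unfolding \<F>_def
    using initial_segment_admits_line_of_sight rational_slope_denominator_exists by blast
  then obtain den where den: "\<forall>F\<in>\<F>. rational_slope_denominator F (den F)"
    by (rule bchoice[THEN exE])
  \<comment> \<open>The extra \<open>1\<close> makes \<open>Q\<close> positive.\<close>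
  define Q where "Q = Max (insert 1 (den ` \<F>))"
  have fin: "finite (insert 1 (den ` \<F>))"
    unfolding \<F>_def using finite_initial_segments by (intro finite.insertI finite_imageI)
  have "Q > 0"
    using Max_ge[OF fin, of 1] by (simp add: Q_def)
  have "dist_S H H' < e"
    if H: "H \<in> slope_fibre \<alpha>" and H': "H' \<in> slope_fibre \<gamma>"
      and small: "dist_R H H' < ennreal (1 / real Q)" for \<alpha> H H'
  proof (cases "H = H'")
    case True
    then show ?thesis
      using assms by (simp add: dist_S_def)
  next
    case False
    have adm: "finite_admits_line_of_sight (comm H H')"
      using initial_segment_admits_line_of_sight[OF H] by (simp add: comm_def)
    have "Suc m < first_diff H H'"
    proof (rule ccontr)
      assume "\<not> Suc m < first_diff H H'"
      then have F: "comm H H' \<in> \<F>"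
        unfolding comm_eq_right \<F>_def using H' not_less by blast
      then have "Q < den (comm H H')"
        using dist_R_less_iff[OF False adm \<open>Q > 0\<close>] small den by blast
      moreover have "den (comm H H') \<le> Q"
        unfolding Q_def using F by (intro Max_ge[OF fin]) blast
      ultimately show False
        by simp
    qed
    moreover have "H 0 = H' 0"
      using H H' by (simp add: slope_fibre_def infinite_hallways_def)
    ultimately have "dist_S H H' < ennreal (1 / real (Suc m))"
      by (subst dist_S_less_iff[OF False]) auto
    then show ?thesis
      using m by (rule less_trans)
  qed
  moreover have "ennreal (1 / real Q) > 0"
    using \<open>Q > 0\<close> by simp
  ultimately show ?thesis
    by blast
qed

lemma induced_dist_tendsto_0_transfer:
  assumes compare: "\<And>e. e > 0 \<Longrightarrow>
      \<exists>d>0. \<forall>\<alpha>. \<forall>H\<in>slope_fibre \<alpha>. \<forall>H'\<in>slope_fibre \<gamma>. d1 H H' < d \<longrightarrow> d2 H H' < e"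
    and lim: "((\<lambda>i. induced_dist d1 (x i) \<gamma>) \<longlongrightarrow> 0) F"
  shows "((\<lambda>i. induced_dist d2 (x i) \<gamma>) \<longlongrightarrow> 0) F"
proof (rule order_tendstoI)
  fix e :: ennreal assume "e > 0"
  then obtain d where "d > 0"
    and d: "\<And>\<alpha> H H'. H \<in> slope_fibre \<alpha> \<Longrightarrow> H' \<in> slope_fibre \<gamma> \<Longrightarrow> d1 H H' < d \<Longrightarrow> d2 H H' < e"
    using compare by blast
  have "\<forall>\<^sub>F i in F. induced_dist d1 (x i) \<gamma> < d"
    using lim \<open>d > 0\<close> by (rule order_tendstoD)
  then show "\<forall>\<^sub>F i in F. induced_dist d2 (x i) \<gamma> < e"
  proof eventually_elim
    case (elim i)
    then obtain H H' where "H \<in> slope_fibre (x i)" "H' \<in> slope_fibre \<gamma>" "d1 H H' < d"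
      by (auto simp: induced_dist_def Inf_less_iff)
    with d show ?case
      by (auto simp: induced_dist_def Inf_less_iff)
  qed
qed simp

theorem proposition52:
  fixes x :: "nat \<Rightarrow> real" and x0 :: real
  assumes "\<And>i. x i \<in> \<real> - \<rat>" and "x0 \<in> \<real> - \<rat>"
  shows "(\<lambda>i. induced_dist dist_R (x i) x0) \<longlonglongrightarrow> 0 \<longleftrightarrow>
         (\<lambda>i. induced_dist dist_S (x i) x0) \<longlonglongrightarrow> 0"
proof
  assume "(\<lambda>i. induced_dist dist_R (x i) x0) \<longlonglongrightarrow> 0"
  from induced_dist_tendsto_0_transfer[OF dist_S_small_if_dist_R_small this]
  show "(\<lambda>i. induced_dist dist_S (x i) x0) \<longlonglongrightarrow> 0" .
next
  assume "(\<lambda>i. induced_dist dist_S (x i) x0) \<longlonglongrightarrow> 0"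
  moreover have "x0 \<notin> \<rat>"
    using assms(2) by simp
  ultimately show "(\<lambda>i. induced_dist dist_R (x i) x0) \<longlonglongrightarrow> 0"
    using induced_dist_tendsto_0_transfer[OF dist_R_small_if_dist_S_small] by metis
qed

end
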